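(* Let $\mathcal M$ be a set of $m$ goods, $\mathcal B$ a set of $m$ buyers, and $\mathbf V=(v_{i,j})_{i\in\mathcal B,\,j\in\mathcal M}$ any valuation matrix with $v_{i,j}\ge 0$. Then the skewed-set aided descending price auction, run on input $\mathbf V$, terminates after at most $m^2$ rounds (iterations of its while loop).
   Context: Market. Each buyer $i\in\mathcal B$ wants at most one good and values good $j\in\mathcal M$ at $v_{i,j}\ge 0$; $|\mathcal B|=|\mathcal M|=m$. For a price vector $\mathbf P=(P_j)_{j\in\mathcal M}$ (real entries), put $U_i^*=\max\{0,\max_{j\in\mathcal M}(v_{i,j}-P_j)\}$ and $L_i=\{j\in\mathcal M: v_{i,j}-P_j=U_i^*\}$ (possibly empty). The preference graph at $\mathbf P$ is the bipartite graph between $\mathcal M$ and $\mathcal B$ in which $j\in\mathcal M$ and $i\in\mathcal B$ are adjacent iff $j\in L_i$. $N(S)$ denotes the set of neighbors of $S$ in the preference graph. A set $S\subseteq\mathcal M$ is a constricted good set if $|S|>|N(S)|$. The skewness of a non-empty $S\subseteq\mathcal M$ is $f(S)=|S|-|N(S)|+\frac1{|S|}$. When the preference graph has no perfect matching, there is a unique non-empty set of goods maximizing $f$; it is called the maximally skewed set. Skewed-set aided descending price auction. Initialize $P_j=\max_{i\in\mathcal B}v_{i,j}$ for every $j\in\mathcal M$ and construct the preference graph. While there exists a constricted good set (equivalently, while the preference graph has no perfect matching): let $S$ be the maximally skewed set of the current preference graph; decrease $P_j$, for all $j\in S$ simultaneously, by $$\min_{i\in\mathcal B\setminus N(S),\ l\in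 S}\Big\{\max\big\{0,\max_{k\in\mathcal M\setminus S}(v_{i,k}-P_k)\big\}-(v_{i,l}-P_l)\Big\}$$ (the inner maximum over an empty set being $-\infty$), leave the other prices unchanged, and reconstruct the preference graph. When no constricted good set exists, return $\mathbf P$. *)

theory Defs
  imports Complex_Main "HOL-Library.While_Combinator"
begin

text \<open>
  Throughout, \<open>M\<close> is the set of goods, \<open>B\<close> the set of buyers, \<open>v i j\<close> the value of
  good \<open>j\<close> for buyer \<open>i\<close>, and \<open>P j\<close> the price of good \<open>j\<close>. Only the values of
  \<open>v\<close> and \<open>P\<close> on \<open>B\<close> and \<open>M\<close> matter.
\<close>

text \<open>
  \<open>max {0, max\<^bsub>j \<in> A\<^esub> (v i j - P j)}\<close>, where the inner maximum over the empty set
  counts as \<open>-\<infinity>\<close>. With \<open>A = M\<close> this is \<open>U\<^sub>i\<^sup>*\<close>.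
\<close>
definition best_payoff :: "('b \<Rightarrow> 'g \<Rightarrow> real) \<Rightarrow> ('g \<Rightarrow> real) \<Rightarrow> 'g set \<Rightarrow> 'b \<Rightarrow> real" where
  "best_payoff v P A i = Max (insert 0 ((\<lambda>j. v i j - P j) ` A))"

definition preferred_goods :: "'g set \<Rightarrow> ('b \<Rightarrow> 'g \<Rightarrow> real) \<Rightarrow> ('g \<Rightarrow> real) \<Rightarrow> 'b \<Rightarrow> 'g set" where
  "preferred_goods M v P i = {j \<in> M. v i j - P j = best_payoff v P M i}"

definition neighbors ::
  "'g set \<Rightarrow> 'b set \<Rightarrow> ('b \<Rightarrow> 'g \<Rightarrow> real) \<Rightarrow> ('g \<Rightarrow> real) \<Rightarrow> 'g set \<Rightarrow> 'b set" where
  "neighbors M B v P S = {i \<in> B. \<exists>j\<in>S. j \<in> preferred_goods M v P i}"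

definition constricted_good_set ::
  "'g set \<Rightarrow> 'b set \<Rightarrow> ('b \<Rightarrow> 'g \<Rightarrow> real) \<Rightarrow> ('g \<Rightarrow> real) \<Rightarrow> 'g set \<Rightarrow> bool" where
  "constricted_good_set M B v P S \<longleftrightarrow> S \<subseteq> M \<and> card S > card (neighbors M B v P S)"

definition skewness ::
  "'g set \<Rightarrow> 'b set \<Rightarrow> ('b \<Rightarrow> 'g \<Rightarrow> real) \<Rightarrow> ('g \<Rightarrow> real) \<Rightarrow> 'g set \<Rightarrow> real" where
  "skewness M B v P S =
     real (card S) - real (card (neighbors M B v P S)) + 1 / real (card S)"

text \<open>
  The description is proper whenever the preference graph has no perfect matching,
  since the maximizer is then unique; the auction uses it only in that case.
\<close>
definition maximally_skewed_set ::
  "'g set \<Rightarrow> 'b set \<Rightarrow> ('b \<Rightarrow> 'g \<Rightarrow> real) \<Rightarrow> ('g \<Rightarrow> real) \<Rightarrow> 'g set" where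
  "maximally_skewed_set M B v P =
     (THE S. S \<subseteq> M \<and> S \<noteq> {} \<and>
        (\<forall>T. T \<subseteq> M \<and> T \<noteq> {} \<longrightarrow> skewness M B v P T \<le> skewness M B v P S))"

definition price_reduction ::
  "'g set \<Rightarrow> 'b set \<Rightarrow> ('b \<Rightarrow> 'g \<Rightarrow> real) \<Rightarrow> ('g \<Rightarrow> real) \<Rightarrow> 'g set \<Rightarrow> real" where
  "price_reduction M B v P S =
     Min {best_payoff v P (M - S) i - (v i l - P l) | i l.
            i \<in> B - neighbors M B v P S \<and> l \<in> S}"

definition initial_price :: "'b set \<Rightarrow> ('b \<Rightarrow> 'g \<Rightarrow> real) \<Rightarrow> 'g \<Rightarrow> real" where
  "initial_price B v j = Max ((\<lambda>i. v i j) ` B)"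

definition auction_round ::
  "'g set \<Rightarrow> 'b set \<Rightarrow> ('b \<Rightarrow> 'g \<Rightarrow> real) \<Rightarrow> ('g \<Rightarrow> real) \<Rightarrow> ('g \<Rightarrow> real)" where
  "auction_round M B v P =
     (let S = maximally_skewed_set M B v P
      in (\<lambda>j. if j \<in> S then P j - price_reduction M B v P S else P j))"

text \<open>
  The loop state is the price vector paired with the number of rounds executed so far.
  The result is \<open>None\<close> exactly if the loop does not terminate.
\<close>
definition skewed_set_auction ::
  "'g set \<Rightarrow> 'b set \<Rightarrow> ('b \<Rightarrow> 'g \<Rightarrow> real) \<Rightarrow> (('g \<Rightarrow> real) \<times> nat) option" where
  "skewed_set_auction M B v =
     while_option
       (\<lambda>(P, n). \<exists>S. constricted_good_set M B v P S)
       (\<lambda>(P, n). (auction_round M B v P, Suc n))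
       (initial_price B v, 0)"

end

(* Write d(S) = |S| - |N(S)|. The maximally skewed set S maximizes d and, as d is supermodular, is
   the least maximizer of d. A round removes only edges between N(S) and M - S, and it adds an edge
   from a buyer outside N(S) to S. Writing d' for the new deficiency, this gives
   d'(T) <= d(T Int S) + d(T Un S) - d(S) <= d(S), and if d'(T) = d(S) then T strictly contains S.
   So in each round either max d drops, or it stays and |S| grows; hence m * (m - d(S)) + |S|,
   which is positive and never exceeds m^2 while the loop runs, increases. *)
theory Submission
  imports Defs
begin

section \<open>Best payoffs as families of inequalities\<close>

lemma best_payoff_eq_iff:
  assumes "finite A" "j \<in> A"
  shows "v i j - P j = best_payoff v P A i \<longleftrightarrow>
         0 \<le> v i j - P j \<and> (\<forall>k\<in>A. v i k - P k \<le> v i j - P j)"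
proof -
  have "v i j - P j = best_payoff v P A i \<longleftrightarrow> best_payoff v P A i = v i j - P j"
    by auto
  also have "\<dots> \<longleftrightarrow> 0 \<le> v i j - P j \<and> (\<forall>k\<in>A. v i k - P k \<le> v i j - P j)"
    unfolding best_payoff_def using assms by (subst Max_eq_iff) auto
  finally show ?thesis .
qed

lemma best_payoff_nonneg: "finite A \<Longrightarrow> 0 \<le> best_payoff v P A i"
  unfolding best_payoff_def by (intro Max_ge) auto

lemma best_payoff_ge: "finite A \<Longrightarrow> k \<in> A \<Longrightarrow> v i k - P k \<le> best_payoff v P A i"
  unfolding best_payoff_def by (intro Max_ge) auto

section \<open>Neighborhoods and deficiency\<close>

locale market =
  fixes M :: "'g set" and B :: "'b set" and v :: "'b \<Rightarrow> 'g \<Rightarrow> real"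
  assumes finM: "finite M" and finB: "finite B" and card_eq: "card B = card M"
begin

abbreviation N :: "('g \<Rightarrow> real) \<Rightarrow> 'g set \<Rightarrow> 'b set" where
  "N \<equiv> neighbors M B v"

text \<open>Integer-valued because the difference may be negative, where subtraction on naturals
  would truncate.\<close>

definition deficiency :: "('g \<Rightarrow> real) \<Rightarrow> 'g set \<Rightarrow> int" where
  "deficiency P S = int (card S) - int (card (N P S))"

lemma mem_neighbors_iff:
  "i \<in> N P S \<longleftrightarrow> i \<in> B \<and>
     (\<exists>j\<in>S. j \<in> M \<and> 0 \<le> v i j - P j \<and> (\<forall>k\<in>M. v i k - P k \<le> v i j - P j))"
  unfolding neighbors_def preferred_goods_def
  by (auto simp: best_payoff_eq_iff[OF finM] intro: bexI)

lemma neighbors_subset: "N P S \<subseteq> B"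
  unfolding neighbors_def by auto

lemma finite_neighbors [simp]: "finite (N P S)"
  using finite_subset[OF neighbors_subset finB] .

lemma neighbors_Un: "N P (S \<union> T) = N P S \<union> N P T"
  unfolding neighbors_def by auto

lemma neighbors_mono: "S \<subseteq> T \<Longrightarrow> N P S \<subseteq> N P T"
  unfolding neighbors_def by auto

lemma deficiency_empty [simp]: "deficiency P {} = 0"
  unfolding deficiency_def neighbors_def by simp

lemma deficiency_le_card: "deficiency P S \<le> int (card S)"
  unfolding deficiency_def by simp

text \<open>Neighborhoods commute with unions, but a common neighbor of \<open>S\<close> and
  \<open>T\<close> need not be adjacent to \<open>S \<inter> T\<close>. So the neighbor count is
  submodular, while cardinality is modular.\<close>

lemma deficiency_supermodular:
  assumes "finite S" "finite T"
  shows "deficiency P S + deficiency P T \<le> deficiency P (S \<union> T) + deficiency P (S \<inter> T)"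
proof -
  have "card (N P (S \<inter> T)) \<le> card (N P S \<inter> N P T)"
    by (intro card_mono Int_greatest neighbors_mono) auto
  then have "card (N P (S \<union> T)) + card (N P (S \<inter> T)) \<le> card (N P S) + card (N P T)"
    using card_Un_Int[of "N P S" "N P T"] by (simp add: neighbors_Un)
  moreover have "card S + card T = card (S \<union> T) + card (S \<inter> T)"
    using assms by (rule card_Un_Int)
  ultimately show ?thesis unfolding deficiency_def by linarith
qed

section \<open>The maximally skewed set\<close>

text \<open>Deficiencies are integers and the reciprocals lie in (0,1], so two reciprocals differ by
  less than 1. They only break ties, in favor of the smaller set: the order is
  lexicographic.\<close>

lemma skewness_le_iff:
  assumes "finite S" "S \<noteq> {}" "finite T" "T \<noteq> {}"
  shows "skewness M B v P T \<le> skewness M B v P S \<longleftrightarrow>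
    deficiency P T < deficiency P S \<or>
    deficiency P T = deficiency P S \<and> card S \<le> card T"
proof -
  have skew: "skewness M B v P X = of_int (deficiency P X) + 1 / real (card X)" for X
    unfolding skewness_def deficiency_def by simp
  have inv: "0 < 1 / real (card X)" "1 / real (card X) \<le> 1" if "finite X" "X \<noteq> {}" for X :: "'g set"
    using that by (auto simp: Suc_le_eq card_gt_0_iff divide_le_eq)
  note S = inv[OF assms(1,2)] and T = inv[OF assms(3,4)]
  consider "deficiency P T + 1 \<le> deficiency P S" | "deficiency P S + 1 \<le> deficiency P T"
    | "deficiency P T = deficiency P S" by linarith
  then show ?thesis
  proof cases
    case 1
    then have "real_of_int (deficiency P T) + 1 \<le> of_int (deficiency P S)" by linarith
    then show ?thesis using 1 S T unfolding skew by linarith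
  next
    case 2
    then have "real_of_int (deficiency P S) + 1 \<le> of_int (deficiency P T)" by linarith
    then show ?thesis using 2 S T unfolding skew by linarith
  next
    case 3
    have "card S > 0" "card T > 0" using assms by (auto simp: card_gt_0_iff)
    then have "1 / real (card T) \<le> 1 / real (card S) \<longleftrightarrow> card S \<le> card T"
      by (simp add: field_simps)
    then show ?thesis using 3 unfolding skew by simp
  qed
qed

text \<open>The loop condition; by Hall's theorem and \<open>card_eq\<close> it says that no perfect
  matching exists.\<close>

abbreviation unmatched :: "('g \<Rightarrow> real) \<Rightarrow> bool" where
  "unmatched P \<equiv> \<exists>S. constricted_good_set M B v P S"

abbreviation mss :: "('g \<Rightarrow> real) \<Rightarrow> 'g set" where
  "mss \<equiv> maximally_skewed_set M B v"

text \<open>Every maximizer of the skewness is contained in all maximizers of the deficiency. Two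
  such sets contain each other, so the description defining \<open>mss P\<close> is proper.\<close>

lemma mss_properties:
  assumes "unmatched P"
  shows "mss P \<subseteq> M" and "0 < deficiency P (mss P)"
    and "\<And>T. T \<subseteq> M \<Longrightarrow> deficiency P T \<le> deficiency P (mss P)"
    and "\<And>T. T \<subseteq> M \<Longrightarrow> deficiency P T = deficiency P (mss P) \<Longrightarrow> mss P \<subseteq> T"
proof -
  let ?good = "\<lambda>S. S \<subseteq> M \<and> S \<noteq> {} \<and>
        (\<forall>T. T \<subseteq> M \<and> T \<noteq> {} \<longrightarrow> skewness M B v P T \<le> skewness M B v P S)"
  obtain C where C: "C \<subseteq> M" "0 < deficiency P C"
    using assms unfolding constricted_good_set_def deficiency_def by auto
  have C_ne: "C \<noteq> {}" using C by auto
  have fin: "finite X" if "X \<subseteq> M" for X using that finM by (rule finite_subset)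
  have good: "0 < deficiency P S \<and> (\<forall>T\<subseteq>M. deficiency P T \<le> deficiency P S \<and>
      (deficiency P T = deficiency P S \<longrightarrow> S \<subseteq> T))" if S: "?good S" for S
  proof -
    have le: "deficiency P T < deficiency P S \<or>
        deficiency P T = deficiency P S \<and> card S \<le> card T" if "T \<subseteq> M" "T \<noteq> {}" for T
      using S that fin skewness_le_iff[of S T P] by blast
    have pos: "0 < deficiency P S" using le[OF C(1) C_ne] C(2) by linarith
    have max: "deficiency P T \<le> deficiency P S" if "T \<subseteq> M" for T
      using le[OF that] pos by (cases "T = {}") auto
    have "S \<subseteq> T" if T: "T \<subseteq> M" "deficiency P T = deficiency P S" for T
    proof -
      \<comment> \<open>The union cannot exceed the maximum, so supermodularity makes the
        intersection a maximizer too. It is non-empty because the maximum is positive, and the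
        tie-break then forbids it to be smaller than \<open>S\<close>.\<close>
      have "deficiency P (S \<union> T) \<le> deficiency P S" using S T by (intro max) auto
      with deficiency_supermodular[of S T P] have "deficiency P S \<le> deficiency P (S \<inter> T)"
        using T S fin by auto
      moreover from this have "S \<inter> T \<noteq> {}" using pos by auto
      ultimately have "card S \<le> card (S \<inter> T)" using le[of "S \<inter> T"] S by auto
      then have "S \<inter> T = S" using S fin by (intro card_seteq) auto
      then show ?thesis by auto
    qed
    then show ?thesis using pos max by blast
  qed
  let ?f = "skewness M B v P" and ?K = "{S. S \<subseteq> M \<and> S \<noteq> {}}"
  have finK: "finite ?K" using finM by simp
  have "Max (?f ` ?K) \<in> ?f ` ?K" using finK C(1) C_ne by (intro Max_in) auto
  then obtain S where S: "Max (?f ` ?K) = ?f S" "S \<in> ?K" by (rule imageE)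
  have "?f T \<le> ?f S" if "T \<in> ?K" for T
    unfolding S(1)[symmetric] using finK that by (intro Max_ge finite_imageI imageI)
  with S(2) have S: "?good S" by blast
  have uniq: "S' = S" if S': "?good S'" for S'
  proof -
    have "deficiency P S \<le> deficiency P S'" "deficiency P S' \<le> deficiency P S"
      using good[OF S'] good[OF S] S S' by simp_all
    then have "deficiency P S = deficiency P S'" by simp
    then have "S \<subseteq> S'" "S' \<subseteq> S" using good[OF S'] good[OF S] S S' by simp_all
    then show ?thesis by simp
  qed
  have mss: "?good (mss P)"
    unfolding maximally_skewed_set_def using S uniq by (rule theI[of ?good])
  note props = good[OF mss]
  show "mss P \<subseteq> M" using mss by simp
  show "0 < deficiency P (mss P)" using props by simp
  show "deficiency P T \<le> deficiency P (mss P)" if "T \<subseteq> M" for T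
    using props that by simp
  show "mss P \<subseteq> T" if "T \<subseteq> M" "deficiency P T = deficiency P (mss P)" for T
    using props that by simp
qed

section \<open>The effect of a round on the preference graph\<close>

text \<open>Otherwise the best good of \<open>S\<close> for \<open>i\<close> would be at least as
  good as 0 and as every good outside \<open>S\<close>, making \<open>i\<close> a neighbor of
  \<open>S\<close>. The strict gap makes the reduction positive.\<close>

lemma price_reduction_gap:
  assumes "S \<subseteq> M" "i \<in> B - N P S" "l \<in> S"
  shows "v i l - P l < best_payoff v P (M - S) i"
proof (rule ccontr)
  assume "\<not> ?thesis"
  then have le: "best_payoff v P (M - S) i \<le> v i l - P l" by simp
  have finS: "finite S" using assms(1) finM by (rule finite_subset)
  define u where "u = Max ((\<lambda>l. v i l - P l) ` S)"
  have "u \<in> (\<lambda>l. v i l - P l) ` S" unfolding u_def using finS assms(3) by (intro Max_in) auto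
  then obtain k where k: "k \<in> S" "u = v i k - P k" by auto
  have u: "v i j - P j \<le> u" if "j \<in> S" for j unfolding u_def using finS that by (intro Max_ge) auto
  have "0 \<le> u"
    using best_payoff_nonneg[of "M - S" v P i] le u[OF assms(3)] finM by auto
  moreover have "v i j - P j \<le> u" if "j \<in> M" for j
    using u best_payoff_ge[of "M - S" j v i P] le u[OF assms(3)] finM that
    by (cases "j \<in> S") fastforce+
  ultimately have "i \<in> N P S" using k assms unfolding mem_neighbors_iff by auto
  then show False using assms by auto
qed

text \<open>The reduction is a minimum over a finite non-empty set of gaps. As a lower bound, it
  stops goods of \<open>S\<close> from overtaking the outside options of buyers not in
  \<open>N P S\<close>; since it is attained, some good ties with them.\<close>

lemma price_reduction_properties:
  assumes "S \<subseteq> M" "S \<noteq> {}" "B - N P S \<noteq> {}"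
  defines "\<delta> \<equiv> price_reduction M B v P S"
  shows "0 < \<delta>"
    and "\<And>i l. i \<in> B - N P S \<Longrightarrow> l \<in> S \<Longrightarrow> v i l - (P l - \<delta>) \<le> best_payoff v P (M - S) i"
    and "\<exists>i\<in>B - N P S. \<exists>l\<in>S. v i l - (P l - \<delta>) = best_payoff v P (M - S) i"
proof -
  let ?G = "{best_payoff v P (M - S) i - (v i l - P l) | i l. i \<in> B - N P S \<and> l \<in> S}"
  have G: "?G = (\<lambda>(i, l). best_payoff v P (M - S) i - (v i l - P l)) ` ((B - N P S) \<times> S)"
    by auto
  have fin: "finite ?G" unfolding G using finB finite_subset[OF assms(1) finM] by auto
  have ne: "?G \<noteq> {}" unfolding G using assms by auto
  have "\<delta> \<in> ?G" unfolding \<delta>_def price_reduction_def using fin ne by (rule Min_in)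
  then obtain i l where il: "i \<in> B - N P S" "l \<in> S" "\<delta> = best_payoff v P (M - S) i - (v i l - P l)"
    by auto
  then show "0 < \<delta>" using price_reduction_gap[OF assms(1)] by simp
  show "\<exists>i\<in>B - N P S. \<exists>l\<in>S. v i l - (P l - \<delta>) = best_payoff v P (M - S) i"
    using il by (intro bexI[of _ i] bexI[of _ l]) auto
  show "v i l - (P l - \<delta>) \<le> best_payoff v P (M - S) i" if "i \<in> B - N P S" "l \<in> S" for i l
  proof -
    have "\<delta> \<le> best_payoff v P (M - S) i - (v i l - P l)"
      unfolding \<delta>_def price_reduction_def using fin that by (intro Min_le) auto
    then show ?thesis by simp
  qed
qed

text \<open>Payoffs rise by the full reduction on \<open>S\<close> and by no more elsewhere, so
  edges into \<open>S\<close> survive. A buyer outside \<open>N P S\<close> keeps all edges, since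
  goods of \<open>S\<close> at most tie with the old favorites. A pair attaining the minimum yields
  a new neighbor of \<open>S\<close>.\<close>

lemma round_neighbors:
  assumes "S \<subseteq> M" "S \<noteq> {}" "B - N P S \<noteq> {}"
  defines "P' \<equiv> \<lambda>j. if j \<in> S then P j - price_reduction M B v P S else P j"
  shows "T \<subseteq> S \<Longrightarrow> N P T \<subseteq> N P' T" and "N P T - N P S \<subseteq> N P' T" and "N P' S \<noteq> N P S"
proof -
  let ?\<delta> = "price_reduction M B v P S"
  note pr = price_reduction_properties[OF assms(1-3)]
  have P'_le: "v i k - P' k \<le> v i k - P k + ?\<delta>" for i k
    unfolding P'_def using pr(1) by simp
  have P'_S: "v i k - P' k = v i k - P k + ?\<delta>" if "k \<in> S" for i k
    unfolding P'_def using that by simp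
  have fin: "finite (M - S)" using finM by simp
  show "N P T \<subseteq> N P' T" if "T \<subseteq> S"
  proof
    fix i assume "i \<in> N P T"
    then obtain j where j: "i \<in> B" "j \<in> T" "j \<in> M" "0 \<le> v i j - P j"
        "\<And>k. k \<in> M \<Longrightarrow> v i k - P k \<le> v i j - P j"
      unfolding mem_neighbors_iff by auto
    have j': "v i j - P' j = v i j - P j + ?\<delta>" using j that by (intro P'_S) auto
    have "v i k - P' k \<le> v i j - P' j" if "k \<in> M" for k
      using P'_le[of i k] j(5)[OF that] j' by linarith
    moreover have "0 \<le> v i j - P' j" using j(4) j' pr(1) by linarith
    ultimately show "i \<in> N P' T" using j unfolding mem_neighbors_iff by auto
  qed
  show "N P T - N P S \<subseteq> N P' T"
  proof
    fix i assume i: "i \<in> N P T - N P S"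
    then have "i \<in> N P T" by simp
    then obtain j where j: "i \<in> B" "j \<in> T" "j \<in> M" "0 \<le> v i j - P j"
        "\<And>k. k \<in> M \<Longrightarrow> v i k - P k \<le> v i j - P j"
      unfolding mem_neighbors_iff by auto
    have jS: "j \<notin> S"
    proof
      assume "j \<in> S"
      then have "i \<in> N P S" using j unfolding mem_neighbors_iff by auto
      then show False using i by simp
    qed
    then have top: "v i j - P j = best_payoff v P (M - S) i"
      using j fin by (subst best_payoff_eq_iff) auto
    have "v i k - P' k \<le> v i j - P' j" if "k \<in> M" for k
      using pr(2)[of i k] j(1) i top j(5)[OF that] jS unfolding P'_def by (cases "k \<in> S") auto
    moreover have "0 \<le> v i j - P' j" using j(4) jS unfolding P'_def by simp
    ultimately show "i \<in> N P' T" using j unfolding mem_neighbors_iff by auto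
  qed
  obtain i l where il: "i \<in> B - N P S" "l \<in> S" "v i l - P' l = best_payoff v P (M - S) i"
    using pr(3) unfolding P'_def by auto
  have "v i k - P' k \<le> v i l - P' l" if "k \<in> M" for k
    using pr(2)[OF il(1), of k] best_payoff_ge[OF fin, of k v i P] that il(3)
    unfolding P'_def by (cases "k \<in> S") auto
  moreover have "0 \<le> v i l - P' l" using il(3) best_payoff_nonneg[OF fin] by simp
  ultimately have "i \<in> N P' S" using il assms(1) unfolding mem_neighbors_iff by auto
  then show "N P' S \<noteq> N P S" using il by auto
qed

text \<open>With \<open>S\<close> for \<open>mss P\<close>, the buyers in
  \<open>N P (T \<inter> S)\<close> and those in \<open>N P (T \<union> S) - N P S\<close> form
  disjoint sets, and all of them are neighbors of \<open>T\<close> after the round. Counting them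
  bounds the new deficiency.\<close>

lemma round_deficiency:
  assumes "unmatched P" "T \<subseteq> M"
  shows "deficiency (auction_round M B v P) T \<le> deficiency P (mss P)"
    and "deficiency (auction_round M B v P) T = deficiency P (mss P) \<Longrightarrow> mss P \<subset> T"
proof -
  define S where "S = mss P"
  define P' where "P' = auction_round M B v P"
  note mss = mss_properties[OF assms(1), folded S_def]
  have P': "P' = (\<lambda>j. if j \<in> S then P j - price_reduction M B v P S else P j)"
    unfolding P'_def auction_round_def S_def by (simp add: Let_def)
  have S_ne: "S \<noteq> {}" using mss(2) by auto
  have finS: "finite S" and finT: "finite T" using mss(1) assms(2) finM finite_subset by auto
  \<comment> \<open>Having as many buyers as goods leaves a buyer outside \<open>N P S\<close>, so
    the price reduction is a minimum over a non-empty set.\<close>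
  have "card (N P S) < card S" using mss(2) unfolding deficiency_def by simp
  also have "\<dots> \<le> card B" using mss(1) finM card_eq by (simp add: card_mono)
  finally have B_ne: "B - N P S \<noteq> {}" by (metis Diff_eq_empty_iff card_mono finite_neighbors not_le)
  note rn = round_neighbors[OF mss(1) S_ne B_ne, folded P']
  have "N P (T \<inter> S) \<union> (N P (T \<union> S) - N P S) \<subseteq> N P' T"
    using rn(1)[of "T \<inter> S"] rn(2)[of T] neighbors_mono[of "T \<inter> S" T P']
    unfolding neighbors_Un by auto
  then have "card (N P (T \<inter> S) \<union> (N P (T \<union> S) - N P S)) \<le> card (N P' T)"
    by (intro card_mono) auto
  moreover have "card (N P (T \<inter> S) \<union> (N P (T \<union> S) - N P S)) =
      card (N P (T \<inter> S)) + card (N P (T \<union> S) - N P S)"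
    using neighbors_mono[of "T \<inter> S" S P] by (intro card_Un_disjoint) auto
  moreover have "card (N P (T \<union> S) - N P S) + card (N P S) = card (N P (T \<union> S))"
    using neighbors_mono[of S "T \<union> S" P] by (simp add: card_Diff_subset card_mono)
  moreover have "card T + card S = card (T \<union> S) + card (T \<inter> S)"
    using finT finS by (rule card_Un_Int)
  ultimately have le: "deficiency P' T + deficiency P S \<le>
      deficiency P (T \<inter> S) + deficiency P (T \<union> S)"
    unfolding deficiency_def by linarith
  have cup: "deficiency P (T \<union> S) \<le> deficiency P S" using mss(1) assms(2) by (intro mss(3)) auto
  have cap: "deficiency P (T \<inter> S) \<le> deficiency P S" using mss(1) by (intro mss(3)) auto
  show "deficiency (auction_round M B v P) T \<le> deficiency P (mss P)"
    using le cup cap unfolding S_def P'_def by linarith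
  show "mss P \<subset> T" if "deficiency (auction_round M B v P) T = deficiency P (mss P)"
  proof -
    have eq: "deficiency P' T = deficiency P S" using that unfolding S_def P'_def .
    \<comment> \<open>Equality forces both terms on the right of \<open>le\<close> to be maximal;
      leastness of \<open>S\<close> among the maximizers then applies to
      \<open>T \<inter> S\<close>.\<close>
    then have "deficiency P (T \<inter> S) = deficiency P S" using le cup cap by linarith
    then have "S \<subseteq> T" using mss(4)[of "T \<inter> S"] assms(2) by auto
    \<comment> \<open>The set \<open>S\<close> itself has gained a neighbor and lost none, so its
      deficiency has dropped.\<close>
    moreover have "T \<noteq> S"
    proof
      assume "T = S"
      then have "card (N P' S) = card (N P S)" using eq unfolding deficiency_def by simp
      moreover have "N P S \<subseteq> N P' S" using rn(1) by simp
      ultimately show False using rn(3) card_subset_eq[OF finite_neighbors] by metis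
    qed
    ultimately show ?thesis unfolding S_def by auto
  qed
qed

section \<open>The potential and termination\<close>

text \<open>Encodes a lexicographic order in one integer: a unit drop of the maximal deficiency
  weighs \<open>card M\<close>, more than any possible loss in the size of \<open>mss P\<close>,
  which lies between 1 and \<open>card M\<close>.\<close>

definition progress :: "('g \<Rightarrow> real) \<Rightarrow> int" where
  "progress P = int (card M) * (int (card M) - deficiency P (mss P)) + int (card (mss P))"

text \<open>The deficiency of \<open>mss P\<close> is at least 1, being a positive integer, and at
  most \<open>card (mss P)\<close>, hence at most \<open>card M\<close>.\<close>

lemma progress_bounds:
  assumes "unmatched P"
  shows "0 < progress P" "progress P \<le> (int (card M))\<^sup>2"
proof -
  note mss = mss_properties[OF assms]
  have c: "card (mss P) \<le> card M" using mss(1) finM by (simp add: card_mono)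
  have d: "deficiency P (mss P) \<le> int (card (mss P))" by (rule deficiency_le_card)
  have "0 \<le> int (card M) * (int (card M) - deficiency P (mss P))" using c d by simp
  then show "0 < progress P" unfolding progress_def using d mss(2) by linarith
  have "int (card M) * (int (card M) - deficiency P (mss P)) \<le> int (card M) * (int (card M) - 1)"
    using mss(2) by (intro mult_left_mono) auto
  then show "progress P \<le> (int (card M))\<^sup>2"
    unfolding progress_def power2_eq_square using c by (simp add: algebra_simps)
qed

lemma progress_round:
  assumes "unmatched P" "unmatched (auction_round M B v P)"
  shows "progress P < progress (auction_round M B v P)"
proof -
  let ?P' = "auction_round M B v P"
  note mss = mss_properties[OF assms(1)] and mss' = mss_properties[OF assms(2)]
  have fin: "finite (mss ?P')" using mss'(1) finM by (rule finite_subset)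
  have c: "card (mss P) \<le> card M" using mss(1) finM by (simp add: card_mono)
  show ?thesis
  proof (cases "deficiency ?P' (mss ?P') = deficiency P (mss P)")
    case True
    then have "card (mss P) < card (mss ?P')"
      using round_deficiency(2)[OF assms(1) mss'(1)] fin by (intro psubset_card_mono) auto
    then show ?thesis unfolding progress_def True by simp
  next
    case False
    then have "deficiency ?P' (mss ?P') + 1 \<le> deficiency P (mss P)"
      using round_deficiency(1)[OF assms(1) mss'(1)] by linarith
    \<comment> \<open>The gain of \<open>card M\<close> covers \<open>card (mss P)\<close>, and the
      new set still contributes a positive size.\<close>
    then have "int (card M) * (int (card M) - deficiency P (mss P) + 1)
        \<le> int (card M) * (int (card M) - deficiency ?P' (mss ?P'))"
      by (intro mult_left_mono) auto
    moreover have "0 < int (card (mss ?P'))"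
      using mss'(2) deficiency_le_card[of ?P' "mss ?P'"] by linarith
    ultimately show ?thesis unfolding progress_def using c by (simp add: algebra_simps)
  qed
qed

text \<open>The round counter starts below the potential and grows by one while the potential grows
  by at least one, so it stays below it and thus below the square of \<open>card M\<close> while the
  loop runs.\<close>

lemma auction_terminates:
  "\<exists>P n. skewed_set_auction M B v = Some (P, n) \<and> n \<le> (card M)\<^sup>2"
proof -
  define b where "b = (\<lambda>(P, n :: nat). unmatched P)"
  define c where "c = (\<lambda>(P, n). (auction_round M B v P, Suc n))"
  \<comment> \<open>The potential is controlled only while a constricted set exists, hence the
    guard. The unguarded bound is not strict, because the last permitted round may bring the counter
    to the square itself.\<close>
  define I where "I = (\<lambda>(P, n). n \<le> (card M)\<^sup>2 \<and> (unmatched P \<longrightarrow> int n < progress P))"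
  have step: "I (c s)" and dec: "(card M)\<^sup>2 - snd (c s) < (card M)\<^sup>2 - snd s" if "I s" "b s" for s
  proof -
    obtain P n where s: "s = (P, n)" by (cases s)
    have P: "unmatched P" using that unfolding s b_def by simp
    have n: "int n < progress P" using that P unfolding s I_def by auto
    have "int n < int ((card M)\<^sup>2)"
      using n progress_bounds(2)[OF P] unfolding of_nat_power by linarith
    then have lt: "n < (card M)\<^sup>2" by (simp only: of_nat_less_iff)
    then show "(card M)\<^sup>2 - snd (c s) < (card M)\<^sup>2 - snd s" unfolding s c_def by simp
    have "int (Suc n) < progress (auction_round M B v P)" if "unmatched (auction_round M B v P)"
      using progress_round[OF P that] n by simp
    then show "I (c s)" using lt unfolding s I_def c_def by simp
  qed
  have init: "I (initial_price B v, 0)" unfolding I_def using progress_bounds(1) by simp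
  obtain t where t: "while_option b c (initial_price B v, 0) = Some t"
    using measure_while_option_Some[of I b c "\<lambda>s. (card M)\<^sup>2 - snd s", OF _ init] step dec by auto
  have "I t" using while_option_rule[of I b c, OF step t init] .
  moreover have "skewed_set_auction M B v = Some t"
    using t unfolding skewed_set_auction_def b_def c_def .
  ultimately show ?thesis unfolding I_def by (cases t) auto
qed

end

theorem mainTheorem3:
  fixes M :: "'g set" and B :: "'b set" and v :: "'b \<Rightarrow> 'g \<Rightarrow> real" and m :: nat
  assumes "finite M" and "card M = m"
    and "finite B" and "card B = m"
    and "\<And>i j. i \<in> B \<Longrightarrow> j \<in> M \<Longrightarrow> v i j \<ge> 0"
  shows "\<exists>P n. skewed_set_auction M B v = Some (P, n) \<and> n \<le> m\<^sup>2"
proof -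
  interpret market M B v using assms by unfold_locales auto
  show ?thesis using auction_terminates assms by simp
qed

end
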